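(* For every integer $n\ge1$, the zigzag map $\zeta^{\mathrm{alt}}_{\mathrm B}$ on $\mathcal{PT}_{\mathrm B}(n)$ is equal to $\varphi\circ\Phi_{\mathrm B}$; that is, for every $T\in\mathcal{PT}_{\mathrm B}(n)$, $\zeta^{\mathrm{alt}}_{\mathrm B}(T)$ and $\varphi(\Phi_{\mathrm B}(T))$ are the same permutation of the set $R(T)$ (which is the set of integers appearing in $\Phi_{\mathrm B}(T)$).
   Context: Shifted Ferrers diagrams: a Ferrers diagram $F$ of length $n$ (rows plus columns, empty rows and columns allowed) has its south-east border steps labeled $1,\dots,n$ from north-east to south-west; a row gets the label of its south step, a column the label of its west step. So $F$ amounts to a splitting of $\{1,\dots,n\}$ into row labels and column labels; rows go top to bottom in increasing label order, columns left to right in decreasing label order, and there is a cell in Row $r$, Column $c$ iff $r<c$. If $F$ has $k$ columns, the shifted Ferrers diagram $\overline F$ is obtained by adding $k$ left-justified rows of sizes $1,2,\dots,k$ (top to bottom) above $F$; its length is that of $F$. The rightmost cells of the added rows are the diagonal cells. The added row whose diagonal cell is in Column $j$ is labeled $-j$; thus Row $-j$ has a cell in Column $c$ iff $c\ge j$ ($c$ a column label), and rows are again ordered top to bottom by increasing label. Type B permutation tableaux: $\mathcal{PT}_{\mathrm B}(n)$ is the set of shifted Ferrers diagrams of length $n$ with a $0,1$-filling such that (1) each column has at least one $1$; (2) there is no $0$ having both a $1$ above it in the same column and a $1$ to the left of it in the same row; (3) if a diagonal cell contains $0$, there is no $1$ to the left of it in the same row. A $0$ is restricted if it has a $1$ above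 it in the same column or it is in a diagonal cell. A row is unrestricted if it contains no restricted $0$. Alternative representation of $T\in\mathcal{PT}_{\mathrm B}(n)$: replace each topmost $1$ (topmost $1$ of its column) by $\uparrow$ and each rightmost restricted $0$ (rightmost restricted $0$ of its row) by $\leftarrow$, erase all other entries, and then cut each diagonal cell along its north-west to south-east diagonal, discarding any arrows in diagonal cells. So arrows remain only in non-diagonal cells, each column has at most one $\uparrow$, and Column $c$ has no $\uparrow$ exactly when the diagonal cell of Column $c$ contains a $1$. $B_n$ is the set of type B permutations: words obtained from a permutation of $\{1,\dots,n\}$ by negating any subset of its entries. The map $\Phi_{\mathrm B}:\mathcal{PT}_{\mathrm B}(n)\to B_n$: let $T$ (in alternative representation) have columns labeled $c_1<\cdots<c_k$. Let $\pi^{(k+1)}$ be the word of the labels of the unrestricted rows of $T$ in increasing order. For $i=k,k-1,\dots,1$, obtain $\pi^{(i)}$ from $\pi^{(i+1)}$ as follows. If Column $c_i$ has a $\uparrow$, in Row $r_0$ say, insert $c_i$ immediately before $r_0$; if not, do nothing (in this case $-c_i$ is already in the word). Then, if $r_1<\cdots<r_s$ are the labels of the rows containing a $\leftarrow$ in Column $c_i$, insert $r_1,\dots,r_s$ in this order immediately before $c_i$ (if Column $c_i$ has a $\uparrow$) or before $-c_i$ (if not). Set $\Phi_{\mathrm B}(T)=\pi^{(1)}$. The map $\varphi$: for a word $w=w_1\cdots w_n$ of distinct integers, $w_i$ is an RL-minimum if $w_i<w_j$ for all $j>i$. If $w_{i_1},\dots,w_{i_k}$ with $i_1<\cdots<i_k=n$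 are the RL-minima, $\varphi(w)$ is the permutation of the set $\{w_1,\dots,w_n\}$ with cycles $(w_1,\dots,w_{i_1}),(w_{i_1+1},\dots,w_{i_2}),\dots,(w_{i_{k-1}+1},\dots,w_{i_k})$, where $(a_1,\dots,a_p)$ sends $a_1\mapsto a_2\mapsto\cdots\mapsto a_p\mapsto a_1$. The zigzag map: for $i\in\{1,\dots,n\}$ put $i_T=-i$ if $i$ is the label of a column having no $\uparrow$ in the alternative representation, and $i_T=i$ otherwise. Let $R(T)=\{1_T,\dots,n_T\}$. For each $i\in\{1,\dots,n\}$, exactly one of Row $i$ (if $i$ is a row label) and Row $-i$ (if $i$ is a column label) exists; consider the path entering from the left end of this row travelling east, which switches direction between east and south each time it meets a cell containing an arrow, and which turns from east to south when it reaches the diagonal (i.e. when travelling east along a Row $-j$ it reaches the diagonal cell in Column $j$, it continues south down Column $j$), until it exits the diagram at the right end of a Row $j$ ($j>0$) or the bottom of a Column $j$. Then $\zeta^{\mathrm{alt}}_{\mathrm B}(T)$ is the permutation of $R(T)$ sending $i_T$ to $j_T$. (It is identified with an element of $B_n$ by listing the images of $1_T,2_T,\dots,n_T$.) *)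

theory Defs
  imports "HOL-Combinatorics.Combinatorics"
begin

section \<open>Shifted Ferrers diagrams and type B permutation tableaux\<close>

text \<open>
  A Ferrers diagram of length \<open>n\<close> is given by the splitting of \<open>{1..n}\<close> into row labels and column
  labels. A 0,1-filling of the associated shifted diagram is given by the set of cells that contain
  a 1; the other cells contain a 0. The pair \<open>(r, c)\<close> stands for the cell in Row \<open>r\<close> and
  Column \<open>c\<close>. A smaller row label is further up and a larger column label is further left.
\<close>

record filled_diagram =
  row_labels :: "int set"
  col_labels :: "int set"
  ones :: "(int \<times> int) set"

definition all_row_labels :: "filled_diagram \<Rightarrow> int set" where
  "all_row_labels T = row_labels T \<union> uminus ` col_labels T"

definition cells :: "filled_diagram \<Rightarrow> (int \<times> int) set" where
  "cells T = {(r, c). r \<in> row_labels T \<and> c \<in> col_labels T \<and> r < c}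
           \<union> {(- j, c) | j c. j \<in> col_labels T \<and> c \<in> col_labels T \<and> j \<le> c}"

definition zeros :: "filled_diagram \<Rightarrow> (int \<times> int) set" where
  "zeros T = cells T - ones T"

definition one_above :: "filled_diagram \<Rightarrow> int \<Rightarrow> int \<Rightarrow> bool" where
  "one_above T r c \<longleftrightarrow> (\<exists>r'. r' < r \<and> (r', c) \<in> ones T)"

definition one_left :: "filled_diagram \<Rightarrow> int \<Rightarrow> int \<Rightarrow> bool" where
  "one_left T r c \<longleftrightarrow> (\<exists>c'. c < c' \<and> (r, c') \<in> ones T)"

definition PT_B :: "nat \<Rightarrow> filled_diagram set" where
  "PT_B n = {T.
     row_labels T \<union> col_labels T = {1..int n} \<and> row_labels T \<inter> col_labels T = {} \<and>
     ones T \<subseteq> cells T \<and>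
     (\<forall>c\<in>col_labels T. \<exists>r. (r, c) \<in> ones T) \<and>
     (\<forall>(r, c)\<in>zeros T. \<not> (one_above T r c \<and> one_left T r c)) \<and>
     (\<forall>j\<in>col_labels T. (- j, j) \<in> zeros T \<longrightarrow> \<not> one_left T (- j) j)}"

definition restricted_zero :: "filled_diagram \<Rightarrow> int \<Rightarrow> int \<Rightarrow> bool" where
  "restricted_zero T r c \<longleftrightarrow> (r, c) \<in> zeros T \<and> (one_above T r c \<or> r = - c)"

definition unrestricted_row :: "filled_diagram \<Rightarrow> int \<Rightarrow> bool" where
  "unrestricted_row T r \<longleftrightarrow> r \<in> all_row_labels T \<and> \<not> (\<exists>c. restricted_zero T r c)"


section \<open>The alternative representation\<close>

text \<open>
  The conjunct \<open>r \<noteq> - c\<close> discards the arrows in diagonal cells. Discarding happens after the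
  topmost 1 and the rightmost restricted 0 are determined, so a row whose rightmost restricted 0 is
  in its diagonal cell has no left arrow at all.
\<close>

definition up_arrow :: "filled_diagram \<Rightarrow> int \<Rightarrow> int \<Rightarrow> bool" where
  "up_arrow T r c \<longleftrightarrow> (r, c) \<in> ones T \<and> \<not> one_above T r c \<and> r \<noteq> - c"

definition left_arrow :: "filled_diagram \<Rightarrow> int \<Rightarrow> int \<Rightarrow> bool" where
  "left_arrow T r c \<longleftrightarrow>
     restricted_zero T r c \<and> \<not> (\<exists>c'. c' < c \<and> restricted_zero T r c') \<and> r \<noteq> - c"

definition has_up_arrow :: "filled_diagram \<Rightarrow> int \<Rightarrow> bool" where
  "has_up_arrow T c \<longleftrightarrow> (\<exists>r. up_arrow T r c)"

text \<open>The number written \<open>i\<^sub>T\<close>, and the set \<open>R(T)\<close> of all of them.\<close>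

definition signed_label :: "filled_diagram \<Rightarrow> int \<Rightarrow> int" where
  "signed_label T i = (if i \<in> col_labels T \<and> \<not> has_up_arrow T i then - i else i)"

definition signed_labels :: "filled_diagram \<Rightarrow> int set" where
  "signed_labels T = signed_label T ` (row_labels T \<union> col_labels T)"


section \<open>The map to type B permutations\<close>

definition type_B_perms :: "nat \<Rightarrow> int list set" where
  "type_B_perms n = {w. distinct (map abs w) \<and> set (map abs w) = {1..int n}}"

text \<open>If \<open>y\<close> is not a letter of \<open>w\<close>, then \<open>xs\<close> goes to the end; for tableaux this does not occur.\<close>

definition insert_before :: "int list \<Rightarrow> int \<Rightarrow> int list \<Rightarrow> int list" where
  "insert_before xs y w = takeWhile (\<lambda>z. z \<noteq> y) w @ xs @ dropWhile (\<lambda>z. z \<noteq> y) w"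

definition Phi_step :: "filled_diagram \<Rightarrow> int \<Rightarrow> int list \<Rightarrow> int list" where
  "Phi_step T c w =
     (let w' = (if has_up_arrow T c then insert_before [c] (THE r. up_arrow T r c) w else w)
      in insert_before (sorted_list_of_set {r. left_arrow T r c}) (signed_label T c) w')"

text \<open>\<open>foldr\<close> treats the columns from the largest label down to the smallest.\<close>

definition Phi_B :: "filled_diagram \<Rightarrow> int list" where
  "Phi_B T = foldr (Phi_step T) (sorted_list_of_set (col_labels T))
     (sorted_list_of_set {r. unrestricted_row T r})"


section \<open>From words to permutations\<close>

definition RL_min :: "int list \<Rightarrow> nat \<Rightarrow> bool" where
  "RL_min w i \<longleftrightarrow> i < length w \<and> (\<forall>j. i < j \<and> j < length w \<longrightarrow> w ! i < w ! j)"

text \<open>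
  The 1-based positions \<open>i\<^sub>1 < \<dots> < i\<^sub>k\<close> of the RL-minima; the \<open>m\<close>-th block consists of the letters
  at the positions after \<open>i\<^bsub>m-1\<^esub>\<close> (with \<open>i\<^sub>0 = 0\<close>) up to and including \<open>i\<^sub>m\<close>.
\<close>

definition RL_min_positions :: "int list \<Rightarrow> nat list" where
  "RL_min_positions w = map Suc (filter (RL_min w) [0..<length w])"

definition RL_min_blocks :: "int list \<Rightarrow> int list list" where
  "RL_min_blocks w =
     map (\<lambda>(a, b). map ((!) w) [a..<b]) (zip (0 # RL_min_positions w) (RL_min_positions w))"

text \<open>A permutation of a set of integers is a function that is the identity outside this set.\<close>

definition phi :: "int list \<Rightarrow> int \<Rightarrow> int" where
  "phi w = foldr (\<circ>) (map cycle_of_list (RL_min_blocks w)) id"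


section \<open>The zigzag map\<close>

datatype direction = East | South

text \<open>The direction in which a path leaves cell \<open>(r, c)\<close> that it enters in direction \<open>d\<close>.\<close>

definition turn :: "filled_diagram \<Rightarrow> direction \<Rightarrow> int \<Rightarrow> int \<Rightarrow> direction" where
  "turn T d r c =
     (if up_arrow T r c \<or> left_arrow T r c then (if d = East then South else East)
      else if r = - c then South else d)"

text \<open>
  The label of the row or column at whose end a path exits that enters cell \<open>(r, c)\<close> in
  direction \<open>d\<close>. The recursion ends on every finite diagram, because the path only moves to cells
  with smaller \<open>c\<close> or larger \<open>r\<close>.
\<close>

partial_function (tailrec) exit_label ::
    "filled_diagram \<Rightarrow> direction \<Rightarrow> int \<Rightarrow> int \<Rightarrow> int" where
  "exit_label T d r c =
     (let right = {c'. c' < c \<and> (r, c') \<in> cells T};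
          below = {r'. r < r' \<and> (r', c) \<in> cells T}
      in if turn T d r c = East
         then if right = {} then r else exit_label T East r (Max right)
         else if below = {} then c else exit_label T South (Min below) c)"

definition start_row :: "filled_diagram \<Rightarrow> int \<Rightarrow> int" where
  "start_row T i = (if i \<in> row_labels T then i else - i)"

text \<open>The path from the left end of an empty row leaves the diagram at the right end of that row.\<close>

definition path_exit :: "filled_diagram \<Rightarrow> int \<Rightarrow> int" where
  "path_exit T i =
     (let r = start_row T i; cs = {c. (r, c) \<in> cells T}
      in if cs = {} then r else exit_label T East r (Max cs))"

text \<open>The absolute value of \<open>i\<^sub>T\<close> is \<open>i\<close>.\<close>

definition zeta_alt_B :: "filled_diagram \<Rightarrow> int \<Rightarrow> int" where
  "zeta_alt_B T x =
     (if x \<in> signed_labels T then signed_label T (path_exit T \<bar>x\<bar>) else x)"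

end

theory Submission
  imports Defs
begin

text \<open>
  Process the columns from left to right and compare, after each of them, the word built so far with
  the zigzag paths cut off at the right end of that column. For the rows and columns whose letters
  are already in the word, the cut-off paths induce the permutation \<open>\<phi>\<close> of the word: a new column
  with an up arrow in Row \<open>r\<^sub>0\<close> and left arrows in Rows \<open>r\<^sub>1, \<dots>, r\<^sub>s\<close> diverts the path that
  arrived in Row \<open>r\<^sub>0\<close>, so that \<open>x \<mapsto> r\<^sub>0\<close> becomes
  \<open>x \<mapsto> r\<^sub>1 \<mapsto> \<dots> \<mapsto> r\<^sub>s \<mapsto> c \<mapsto> r\<^sub>0\<close>; a column without an up arrow acts in the same way on the path
  that arrives at its diagonal cell. On the side of words, the new letters are larger than the letter
  they are put in front of, or than the one after it, so they are not RL-minima, the blocks are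
  unchanged otherwise, and the insertion happens inside a cycle.
\<close>

section \<open>RL-minima and insertion of letters\<close>

text \<open>Only two values change: the letter formerly sent to \<open>y\<close> now goes to
  \<open>x\<close>, and \<open>x\<close>, formerly fixed, goes to \<open>y\<close>. Swapping the
  values \<open>x\<close> and \<open>y\<close> does both.\<close>

lemma cycle_of_list_insert:
  assumes "distinct (u @ x # y # v)"
  shows "cycle_of_list (u @ x # y # v) = transpose x y \<circ> cycle_of_list (u @ y # v)"
  using assms
proof (induction u rule: induct_list012)
  case 1
  show ?case by simp
next
  case (2 a)
  have "transpose a x \<circ> transpose x y = transpose x y \<circ> transpose a y"
    using 2 by (auto simp: fun_eq_iff transpose_def)
  then show ?case by (simp add: fun_eq_iff)
next
  case (3 a b u)
  have "transpose a b \<circ> transpose x y = transpose x y \<circ> transpose a b"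
    using 3(3) by (auto simp: fun_eq_iff transpose_def)
  moreover have "cycle_of_list ((b # u) @ x # y # v) = transpose x y \<circ> cycle_of_list ((b # u) @ y # v)"
    by (rule 3(2)) (use 3(3) in auto)
  ultimately show ?case
    by (simp only: append_Cons cycle_of_list.simps comp_assoc [symmetric])
qed

lemma RL_min_append:
  assumes "i < length v"
  shows "RL_min (p @ v) (length p + i) \<longleftrightarrow> RL_min v i"
proof
  assume R: "RL_min (p @ v) (length p + i)"
  have "v ! i < v ! j" if "i < j" "j < length v" for j
  proof -
    have "(p @ v) ! (length p + i) < (p @ v) ! (length p + j)"
      using R that unfolding RL_min_def by (auto simp del: nth_append_length_plus)
    then show ?thesis by (simp only: nth_append_length_plus)
  qed
  then show "RL_min v i" using assms by (simp add: RL_min_def)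
next
  assume R: "RL_min v i"
  have "(p @ v) ! (length p + i) < (p @ v) ! j" if j: "length p + i < j" "j < length p + length v" for j
  proof -
    obtain k where "j = length p + k" using le_Suc_ex[OF order_less_imp_le, OF add_lessD1, OF j(1)] by blast
    then show ?thesis using R j by (simp add: RL_min_def nth_append_length_plus)
  qed
  then show "RL_min (p @ v) (length p + i)" using assms by (simp add: RL_min_def)
qed

lemma filter_upt_RL_min_append:
  "filter (RL_min (p @ v)) [length p..<length p + length v] =
     map ((+) (length p)) (filter (RL_min v) [0..<length v])"
proof -
  have "[length p..<length p + length v] = map ((+) (length p)) [0..<length v]"
    using map_add_upt[of "length p" "length v"] by (simp add: add.commute [of "length p"] cong: map_cong)
  then show ?thesis
    by (auto simp: filter_map o_def RL_min_append intro!: filter_cong)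
qed

text \<open>The global minimum spoils every position before it and is itself an RL-minimum; behind
  it only the suffix matters. Positions are 1-based, hence \<open>Suc (length p)\<close>.\<close>

lemma RL_min_positions_append_Min:
  assumes "\<forall>x\<in>set p \<union> set v. m < x"
  shows "RL_min_positions (p @ m # v) =
    Suc (length p) # map ((+) (Suc (length p))) (RL_min_positions v)"
proof -
  let ?w = "p @ m # v"
  have upt: "[0..<length ?w] = [0..<length p] @ length p # [Suc (length p)..<Suc (length p) + length v]"
    using upt_add_eq_append[of 0 "length p" "Suc (length v)"] by (simp add: upt_conv_Cons del: upt_Suc)
  have "\<not> RL_min ?w i" if "i < length p" for i
  proof
    assume "RL_min ?w i"
    then have "?w ! i < ?w ! length p" using that unfolding RL_min_def by (auto simp del: nth_append_length)
    then have "p ! i < m" using that by (simp add: nth_append)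
    moreover have "m < p ! i" using that assms by simp
    ultimately show False by simp
  qed
  then have 1: "filter (RL_min ?w) [0..<length p] = []" by (auto simp: filter_empty_conv)
  have 2: "RL_min ?w (length p)"
  proof -
    have "?w ! length p < ?w ! j" if j: "length p < j" "j < length ?w" for j
    proof -
      obtain i where "j = length p + Suc i" using less_imp_Suc_add[OF j(1)] by auto
      then show ?thesis using j assms by (simp add: nth_append)
    qed
    then show ?thesis by (simp add: RL_min_def)
  qed
  have 3: "filter (RL_min ?w) [Suc (length p)..<Suc (length p) + length v] =
     map ((+) (Suc (length p))) (filter (RL_min v) [0..<length v])"
    using filter_upt_RL_min_append[of "p @ [m]" v] by simp
  show ?thesis
    unfolding RL_min_positions_def upt filter_append filter.simps 1 3 using 2 by simp
qed

lemma RL_min_blocks_append_Min: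
  assumes "\<forall>x\<in>set p \<union> set v. m < x"
  shows "RL_min_blocks (p @ m # v) = (p @ [m]) # RL_min_blocks v"
proof -
  let ?k = "Suc (length p)"
  let ?P = "RL_min_positions v"
  \<comment> \<open>The end \<open>Suc (length p)\<close> of the first block plays the part that the
    leading \<open>0\<close> plays for \<open>v\<close>, so the remaining pairs are a plain
    shift.\<close>
  have z: "zip (0 # RL_min_positions (p @ m # v)) (RL_min_positions (p @ m # v)) =
     (0, ?k) # map (map_prod ((+) ?k) ((+) ?k)) (zip (0 # ?P) ?P)"
  proof -
    have "?k # map ((+) ?k) ?P = map ((+) ?k) (0 # ?P)" by simp
    then show ?thesis
      unfolding RL_min_positions_append_Min[OF assms] zip_Cons_Cons
      by (simp only: zip_map_map map_prod_def)
  qed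
  have first: "map ((!) (p @ m # v)) [0..<?k] = p @ [m]"
    by (rule nth_equalityI) (auto simp: nth_append less_Suc_eq)
  have shift: "map ((!) (p @ m # v)) [?k + a..<?k + b] = map ((!) v) [a..<b]" for a b
    by (rule nth_equalityI) (auto simp: nth_append simp del: upt_Suc)
  show ?thesis
    unfolding RL_min_blocks_def z list.map map_map prod.case first
    by (simp only: split_beta' map_prod_def fst_conv snd_conv o_def shift)
qed

text \<open>This recursion replaces positions altogether: together with \<open>phi_Nil\<close> it is
  what the inductions on words below rest on.\<close>

lemma phi_append_Min:
  assumes "\<forall>x\<in>set p \<union> set v. m < x"
  shows "phi (p @ m # v) = cycle_of_list (p @ [m]) \<circ> phi v"
  unfolding phi_def RL_min_blocks_append_Min[OF assms] by simp

lemma phi_Nil: "phi [] = id"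
  by (simp add: phi_def RL_min_blocks_def RL_min_positions_def)

lemma split_at_Min:
  fixes w :: "int list"
  assumes "distinct w" "w \<noteq> []"
  obtains p m v where "w = p @ m # v" "\<forall>x\<in>set p \<union> set v. m < x"
proof -
  define m where "m = Min (set w)"
  have "m \<in> set w" using assms(2) by (simp add: m_def)
  then obtain p v where pv: "w = p @ m # v" by (meson split_list)
  have "m < x" if "x \<in> set p \<union> set v" for x
  proof -
    have "m \<le> x" unfolding m_def by (rule Min_le) (use that pv in auto)
    moreover have "x \<noteq> m" using that assms(1) pv by auto
    ultimately show ?thesis by simp
  qed
  then show ?thesis using that pv by blast
qed

lemma phi_permutes:
  assumes "distinct w"
  shows "phi w permutes set w"
  using assms
proof (induction w rule: length_induct)
  case (1 w)
  show ?case
  proof (cases "w = []")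
    case True
    then show ?thesis unfolding True phi_Nil by (simp only: permutes_id)
  next
    case False
    then obtain p m v where w: "w = p @ m # v" and m: "\<forall>x\<in>set p \<union> set v. m < x"
      using split_at_Min 1(2) by blast
    have "phi v permutes set w"
    proof (rule permutes_subset)
      show "phi v permutes set v" using 1 w by auto
    qed (use w in auto)
    moreover have "cycle_of_list (p @ [m]) permutes set w"
      using 1(2) w by (intro permutes_subset[OF cycle_permutes]) auto
    ultimately show ?thesis unfolding w phi_append_Min[OF m] by (rule permutes_compose)
  qed
qed

text \<open>Every letter of an increasing word is an RL-minimum, so all cycles are trivial. The word
  of unrestricted rows is of this kind.\<close>

lemma phi_sorted:
  assumes "sorted w" "distinct w"
  shows "phi w = id"
  using assms
proof (induction w)
  case Nil
  show ?case by (rule phi_Nil)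
next
  case (Cons a w)
  then have "phi ([] @ a # w) = cycle_of_list ([] @ [a]) \<circ> phi w"
    by (intro phi_append_Min) (auto simp: order_less_le)
  then show ?case using Cons by simp
qed

text \<open>The hypothesis on \<open>z\<close> says that the new letter \<open>x\<close> is not an RL-minimum.\<close>

lemma phi_insert:
  assumes "distinct (u @ x # y # v)" "z \<in> set (y # v)" "z < x"
  shows "phi (u @ x # y # v) = transpose x y \<circ> phi (u @ y # v)"
  using assms(1)
proof (induction u rule: length_induct)
  case (1 u)
  obtain p m q where w: "u @ y # v = p @ m # q" and m: "\<forall>x\<in>set p \<union> set q. m < x"
    using split_at_Min[of "u @ y # v"] 1(2) by auto
  \<comment> \<open>The hypothesis on \<open>z\<close> puts \<open>x\<close> above the global
    minimum, so the longer word splits at the same \<open>m\<close>.\<close>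
  have "z \<in> set (p @ m # q)" unfolding w[symmetric] using assms(2) by auto
  then have "m \<le> z" using m by (auto intro: order_less_imp_le)
  then have mx: "m < x" using assms(3) by simp
  obtain us where us: "u = p @ us \<and> us @ y # v = m # q \<or> u @ us = p \<and> y # v = us @ m # q"
    using w unfolding append_eq_append_conv2 by blast
  show ?case
  \<comment> \<open>Either \<open>y\<close> lies in the first block \<open>p @ [m]\<close>, possibly
    as \<open>m\<close> itself, and that cycle grows; or it lies behind \<open>m\<close>, and the
    induction hypothesis applies to the suffix.\<close>
  proof (cases "length u \<le> length p")
    case True
    obtain r where r: "p = u @ r" "y # v = r @ m # q"
    proof (cases "us = []")
      case Nil: True
      show thesis by (rule that[of "[]"]) (use us in \<open>simp_all add: Nil\<close>)
    next
      case False
      then have "u @ us = p \<and> y # v = us @ m # q" using us True by auto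
      then show thesis using that by blast
    qed
    have "phi ((u @ x # r) @ m # q) = cycle_of_list ((u @ x # r) @ [m]) \<circ> phi q"
      using m mx r by (intro phi_append_Min) auto
    also have "cycle_of_list ((u @ x # r) @ [m]) = transpose x y \<circ> cycle_of_list ((u @ r) @ [m])"
    proof -
      obtain v' where "r @ [m] = y # v'" using r(2) by (cases r) auto
      moreover have "distinct (u @ x # r @ [m])" using 1(2) r by auto
      ultimately show ?thesis using cycle_of_list_insert[of u x y v'] by simp
    qed
    finally have "phi (u @ x # r @ m # q) = transpose x y \<circ> (cycle_of_list (p @ [m]) \<circ> phi q)"
      by (simp only: r(1) append_assoc append_Cons comp_assoc)
    then show ?thesis unfolding w phi_append_Min[OF m] by (simp only: r(2))
  next
    case False
    with us have *: "u = p @ us" "us @ y # v = m # q" by auto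
    with False obtain u2 where "us = m # u2" by (cases us) auto
    with * have u: "u = p @ m # u2" "q = u2 @ y # v" by simp_all
    let ?c = "cycle_of_list (p @ [m])"
    have "phi (p @ m # u2 @ x # y # v) = ?c \<circ> phi (u2 @ x # y # v)"
      using m mx u by (intro phi_append_Min) auto
    also have "phi (u2 @ x # y # v) = transpose x y \<circ> phi q"
    proof -
      have "length u2 < length u" "distinct (u2 @ x # y # v)" using 1(2) u by auto
      with 1(1) show ?thesis unfolding u(2) by blast
    qed
    \<comment> \<open>Neither \<open>x\<close> nor \<open>y\<close> occurs in the first block, so
      its cycle fixes both and commutes with their transposition.\<close>
    also have "?c \<circ> (transpose x y \<circ> phi q) = transpose x y \<circ> (?c \<circ> phi q)"
    proof -
      have c: "?c permutes set (p @ [m])" by (rule cycle_permutes)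
      have "?c x = x" by (rule permutes_not_in[OF c]) (use 1(2) u in auto)
      moreover have "?c y = y" by (rule permutes_not_in[OF c]) (use 1(2) u in auto)
      moreover note permutes_bij[OF c]
      ultimately have "?c \<circ> transpose x y = transpose x y \<circ> ?c"
        using transpose_comp_eq[of ?c x y] by (simp add: inv_f_eq bij_is_inj)
      then show ?thesis by (simp only: comp_assoc [symmetric])
    qed
    finally show ?thesis unfolding u(1) w[unfolded u(1)] phi_append_Min[OF m] by simp
  qed
qed

section \<open>Arrows and paths in a tableau\<close>

text \<open>The rest of a path in Row \<open>r\<close> once the columns with label at least
  \<open>b\<close> are behind it. The border \<open>b\<close> may be any integer, which lets paths
  be cut between columns; \<open>south_exit\<close> likewise resumes strictly below Row
  \<open>r\<close>.\<close>

definition east_exit :: "filled_diagram \<Rightarrow> int \<Rightarrow> int \<Rightarrow> int" where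
  "east_exit T r b =
     (let right = {c'. c' < b \<and> (r, c') \<in> cells T}
      in if right = {} then r else exit_label T East r (Max right))"

definition south_exit :: "filled_diagram \<Rightarrow> int \<Rightarrow> int \<Rightarrow> int" where
  "south_exit T r c =
     (let below = {r'. r < r' \<and> (r', c) \<in> cells T}
      in if below = {} then c else exit_label T South (Min below) c)"

lemma exit_label_eq:
  "exit_label T d r c = (if turn T d r c = East then east_exit T r c else south_exit T r c)"
  by (subst exit_label.simps) (simp add: east_exit_def south_exit_def Let_def)

locale type_B_tableau =
  fixes n :: nat and T :: filled_diagram
  assumes tableau: "T \<in> PT_B n"
begin

abbreviation rows where "rows \<equiv> row_labels T"
abbreviation cols where "cols \<equiv> col_labels T"
abbreviation arrow where "arrow r c \<equiv> up_arrow T r c \<or> left_arrow T r c"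

lemma labels_Un: "rows \<union> cols = {1..int n}"
  and labels_disjoint: "rows \<inter> cols = {}"
  and ones_cells: "ones T \<subseteq> cells T"
  and column_has_one: "c \<in> cols \<Longrightarrow> \<exists>r. (r, c) \<in> ones T"
  and zero_cond: "(r, c) \<in> zeros T \<Longrightarrow> \<not> (one_above T r c \<and> one_left T r c)"
  and diagonal_zero_cond: "c \<in> cols \<Longrightarrow> (- c, c) \<in> zeros T \<Longrightarrow> \<not> one_left T (- c) c"
  using tableau by (auto simp: PT_B_def)

lemma rowsD: "r \<in> rows \<Longrightarrow> 1 \<le> r \<and> r \<le> int n \<and> r \<notin> cols"
  using labels_Un labels_disjoint by auto

lemma colsD: "c \<in> cols \<Longrightarrow> 1 \<le> c \<and> c \<le> int n \<and> c \<notin> rows"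
  using labels_Un labels_disjoint by auto

lemma finite_cols: "finite cols"
  using labels_Un by (metis finite_Un finite_atLeastAtMost_int)

lemma all_row_labels_iff: "r \<in> all_row_labels T \<longleftrightarrow> r \<in> rows \<or> - r \<in> cols"
  by (force simp: all_row_labels_def)

text \<open>One description serves both kinds of rows: for a positive label the bound
  \<open>- c \<le> r\<close> is automatic, for \<open>r = - j\<close> the bound \<open>r < c\<close>
  is.\<close>

lemma cells_iff: "(r, c) \<in> cells T \<longleftrightarrow> c \<in> cols \<and> r \<in> all_row_labels T \<and> - c \<le> r \<and> r < c"
proof -
  have "(r, c) \<in> cells T \<longleftrightarrow> c \<in> cols \<and> (r \<in> rows \<and> r < c \<or> - r \<in> cols \<and> - r \<le> c)"
    unfolding cells_def by (auto intro: exI[of _ "- r"])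
  then show ?thesis
    unfolding all_row_labels_iff using rowsD[of r] colsD[of c] colsD[of "- r"] by auto
qed

lemma finite_cells_row: "finite {c. P c \<and> (r, c) \<in> cells T}"
  using finite_cols by (rule rev_finite_subset) (auto simp: cells_iff)

lemma finite_cells_column: "finite {r. P r \<and> (r, c) \<in> cells T}"
  by (rule finite_subset[of _ "{- c..c}"]) (auto simp: cells_iff)

lemma up_arrow_cell: "up_arrow T r c \<Longrightarrow> (r, c) \<in> cells T"
  using ones_cells by (auto simp: up_arrow_def)

lemma left_arrow_cell: "left_arrow T r c \<Longrightarrow> (r, c) \<in> cells T"
  by (auto simp: left_arrow_def restricted_zero_def zeros_def)

lemma up_arrow_unique: "up_arrow T r c \<Longrightarrow> up_arrow T r' c \<Longrightarrow> r = r'"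
  by (force simp: up_arrow_def one_above_def)

lemma left_arrow_unique: "left_arrow T r c \<Longrightarrow> left_arrow T r c' \<Longrightarrow> c = c'"
  unfolding left_arrow_def by (meson linorder_neqE)

text \<open>Off the diagonal a 0 is restricted only through a 1 above it, and the topmost 1 is not
  below that 1.\<close>

lemma left_arrow_below_up_arrow:
  assumes "up_arrow T r c" "left_arrow T r' c"
  shows "r < r'"
proof -
  obtain q where "q < r'" "(q, c) \<in> ones T"
    using assms(2) by (auto simp: left_arrow_def restricted_zero_def one_above_def)
  moreover have "\<not> q < r"
    using assms(1) calculation(2) by (auto simp: up_arrow_def one_above_def)
  ultimately show ?thesis by simp
qed

text \<open>The 0 under a left arrow has a 1 above it, so condition (2) forbids a 1 to its left. A
  left arrow further left would not mark the rightmost restricted 0.\<close>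

lemma no_arrow_before_left_arrow:
  assumes "left_arrow T r c" "c < c'"
  shows "\<not> arrow r c'"
proof -
  have "restricted_zero T r c" "r \<noteq> - c" using assms by (auto simp: left_arrow_def)
  then have "\<not> one_left T r c" using zero_cond by (auto simp: restricted_zero_def)
  then have "\<not> up_arrow T r c'" using assms by (auto simp: up_arrow_def one_left_def)
  moreover have "\<not> left_arrow T r c'"
    using \<open>restricted_zero T r c\<close> assms(2) by (auto simp: left_arrow_def)
  ultimately show ?thesis by simp
qed

text \<open>The diagonal cell is the top cell of its column. A 1 there is the topmost 1 and its
  arrow is discarded; a 0 there leaves the topmost 1, which exists by condition (1), off the
  diagonal.\<close>

lemma has_up_arrow_iff:
  assumes c: "c \<in> cols"
  shows "has_up_arrow T c \<longleftrightarrow> (- c, c) \<in> zeros T"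
proof -
  have cell: "(- c, c) \<in> cells T"
    using c colsD[of c] by (auto simp: cells_iff all_row_labels_iff)
  show ?thesis
  proof (cases "(- c, c) \<in> ones T")
    case True
    have "\<not> up_arrow T r c" for r
    proof
      assume r: "up_arrow T r c"
      then have "- c < r" using up_arrow_cell[OF r] by (auto simp: cells_iff up_arrow_def)
      with True r show False by (auto simp: up_arrow_def one_above_def)
    qed
    with True show ?thesis by (auto simp: has_up_arrow_def zeros_def)
  next
    case False
    let ?R = "{r. True \<and> (r, c) \<in> cells T} \<inter> {r. (r, c) \<in> ones T}"
    have R: "finite ?R" using finite_cells_column by (rule finite_Int[OF disjI1])
    moreover have "?R \<noteq> {}" using column_has_one[OF c] ones_cells by auto
    ultimately have "Min ?R \<in> ?R" by (rule Min_in)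
    moreover have "\<not> one_above T (Min ?R) c"
    proof
      assume "one_above T (Min ?R) c"
      then obtain q where "q < Min ?R" "q \<in> ?R" using ones_cells by (auto simp: one_above_def)
      then show False using Min_le[OF R] by fastforce
    qed
    ultimately have "up_arrow T (Min ?R) c" using False by (auto simp: up_arrow_def)
    then show ?thesis using False cell by (auto simp: has_up_arrow_def zeros_def)
  qed
qed

text \<open>Condition (3) excludes every 1 in Row \<open>- c\<close>, and the diagonal 0 is already
  the rightmost restricted 0, whose arrow is discarded.\<close>

lemma no_arrow_above_diagonal_zero:
  assumes "c \<in> cols" "has_up_arrow T c"
  shows "\<not> arrow (- c) c'"
proof
  assume a: "arrow (- c) c'"
  then have "(- c, c') \<in> cells T" "c' \<noteq> c"
    using up_arrow_cell left_arrow_cell by (auto simp: up_arrow_def left_arrow_def)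
  then have "c < c'" by (auto simp: cells_iff)
  have z: "(- c, c) \<in> zeros T" using assms has_up_arrow_iff by simp
  then have "\<not> up_arrow T (- c) c'"
    using \<open>c < c'\<close> diagonal_zero_cond[OF assms(1)] by (auto simp: up_arrow_def one_left_def)
  moreover have "\<not> left_arrow T (- c) c'"
    using z \<open>c < c'\<close> by (auto simp: left_arrow_def restricted_zero_def)
  ultimately show False using a by simp
qed

text \<open>Moving the border by one, with missing cells skipped, turns jumps to the next cell into
  unit steps and allows induction over the integers.\<close>

lemma east_exit_step:
  "east_exit T r (b + 1) =
     (if (r, b) \<in> cells T then exit_label T East r b else east_exit T r b)"
proof (cases "(r, b) \<in> cells T")
  case True
  let ?R = "{c'. c' < b + 1 \<and> (r, c') \<in> cells T}"
  have "Max ?R = b" by (rule Max_eqI) (use True finite_cells_row in auto)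
  moreover have "b \<in> ?R" using True by simp
  then have "?R \<noteq> {}" by blast
  ultimately show ?thesis using True unfolding east_exit_def Let_def
    by (simp only: if_True if_False)
next
  case False
  then have "{c'. c' < b + 1 \<and> (r, c') \<in> cells T} = {c'. c' < b \<and> (r, c') \<in> cells T}"
    by (auto simp: order_le_less)
  then show ?thesis using False by (simp add: east_exit_def)
qed

lemma south_exit_step:
  "south_exit T q c =
     (if (q + 1, c) \<in> cells T then exit_label T South (q + 1) c else south_exit T (q + 1) c)"
proof (cases "(q + 1, c) \<in> cells T")
  case True
  let ?R = "{r'. q < r' \<and> (r', c) \<in> cells T}"
  have "Min ?R = q + 1" by (rule Min_eqI) (use True finite_cells_column in auto)
  moreover have "q + 1 \<in> ?R" using True by simp
  then have "?R \<noteq> {}" by blast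
  ultimately show ?thesis using True unfolding south_exit_def Let_def
    by (simp only: if_True if_False)
next
  case False
  then have "{r'. q < r' \<and> (r', c) \<in> cells T} = {r'. q + 1 < r' \<and> (r', c) \<in> cells T}"
    by (auto simp: order_less_le add1_zle_eq)
  then show ?thesis using False by (simp add: south_exit_def)
qed

text \<open>A diagonal cell turns an eastbound path even without an arrow, hence the condition
  \<open>r \<noteq> - c\<close>; a southbound path passes straight through it.\<close>

lemma east_exit_skip:
  assumes "b \<le> b'" "\<And>c. b \<le> c \<Longrightarrow> c < b' \<Longrightarrow> \<not> arrow r c \<and> r \<noteq> - c"
  shows "east_exit T r b' = east_exit T r b"
  using assms
proof (induction b' rule: int_ge_induct)
  case (step i)
  then have "turn T East r i = East" by (auto simp: turn_def)
  then have "east_exit T r (i + 1) = east_exit T r i"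
    by (simp add: east_exit_step exit_label_eq)
  then show ?case using step by simp
qed simp

lemma south_exit_skip:
  assumes "q \<le> q'" "\<And>r. q < r \<Longrightarrow> r \<le> q' \<Longrightarrow> \<not> arrow r c"
  shows "south_exit T q c = south_exit T q' c"
  using assms
proof (induction q' rule: int_ge_induct)
  case (step i)
  then have "turn T South (i + 1) c = South" by (auto simp: turn_def)
  then have "south_exit T i c = south_exit T (i + 1) c"
    using south_exit_step[of i c] by (simp add: exit_label_eq)
  then show ?case using step by simp
qed simp

lemma south_exit_arrow:
  assumes "q < r" "arrow r c" "\<And>r'. q < r' \<Longrightarrow> r' < r \<Longrightarrow> \<not> arrow r' c"
  shows "south_exit T q c = east_exit T r c"
proof -
  have "south_exit T q c = south_exit T (r - 1) c"
    using assms by (intro south_exit_skip) auto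
  also have "\<dots> = exit_label T South r c"
    using assms(2) up_arrow_cell left_arrow_cell south_exit_step[of "r - 1" c] by auto
  also have "\<dots> = east_exit T r c"
    using assms(2) by (auto simp: exit_label_eq turn_def)
  finally show ?thesis .
qed

lemma south_exit_bottom:
  assumes "\<And>r. q < r \<Longrightarrow> \<not> arrow r c"
  shows "south_exit T q c = c"
proof -
  \<comment> \<open>Cells of Column \<open>c\<close> lie in rows with label below \<open>c\<close>,
    so nothing is left beneath \<open>max q c\<close>.\<close>
  have "south_exit T q c = south_exit T (max q c) c"
    using assms by (intro south_exit_skip) auto
  also have "\<dots> = c"
  proof -
    have "{r'. max q c < r' \<and> (r', c) \<in> cells T} = {}" by (auto simp: cells_iff)
    then show ?thesis by (simp add: south_exit_def)
  qed
  finally show ?thesis .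
qed

lemma east_exit_arrow:
  assumes "arrow r c"
  shows "east_exit T r (c + 1) = south_exit T r c"
  using assms up_arrow_cell left_arrow_cell
  by (auto simp: east_exit_step exit_label_eq turn_def)

lemma east_exit_diagonal:
  assumes "c \<in> cols"
  shows "east_exit T (- c) (c + 1) = south_exit T (- c) c"
proof -
  have "(- c, c) \<in> cells T" using assms colsD[of c] by (auto simp: cells_iff all_row_labels_iff)
  then show ?thesis
    by (auto simp: east_exit_step exit_label_eq turn_def up_arrow_def left_arrow_def)
qed

text \<open>All column labels are at most \<open>n\<close>, so the border \<open>int n + 1\<close>
  is the left end of every row, empty rows included.\<close>

lemma path_exit_eq: "path_exit T i = east_exit T (start_row T i) (int n + 1)"
proof -
  have "{c. (r, c) \<in> cells T} = {c. c < int n + 1 \<and> (r, c) \<in> cells T}" for r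
    using colsD by (force simp: cells_iff)
  then show ?thesis by (simp add: path_exit_def east_exit_def Let_def)
qed

lemma start_row_row: "r \<in> all_row_labels T \<Longrightarrow> start_row T \<bar>r\<bar> = r"
  using rowsD[of r] colsD[of "- r"] by (auto simp: start_row_def all_row_labels_iff)

section \<open>The partially built word\<close>

text \<open>
  \<open>alive b\<close> are the letters of the word after the columns with label at least \<open>b\<close> have been
  processed, and \<open>cont b y\<close> is where a path ends that has just passed these columns in Row \<open>y\<close>,
  or that has already left the diagram when \<open>y\<close> is the letter of one of these columns.
\<close>

definition alive :: "int \<Rightarrow> int set" where
  "alive b = {r \<in> all_row_labels T. (r \<in> rows \<or> \<not> has_up_arrow T (- r)) \<and> (\<forall>c<b. \<not> left_arrow T r c)}
     \<union> {c \<in> cols. b \<le> c \<and> has_up_arrow T c}"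

definition word :: "int \<Rightarrow> int list" where
  "word b = foldr (Phi_step T) (sorted_list_of_set {c \<in> cols. b \<le> c})
     (sorted_list_of_set {r. unrestricted_row T r})"

definition cont :: "int \<Rightarrow> int \<Rightarrow> int" where
  "cont b y = (if y \<in> rows \<or> - y \<in> cols \<and> - y < b then signed_label T (east_exit T y b) else y)"

lemma row_not_col: "r \<in> all_row_labels T \<Longrightarrow> r \<notin> cols"
  using rowsD[of r] colsD[of r] colsD[of "- r"] by (auto simp: all_row_labels_iff)

lemma left_arrowD:
  assumes "left_arrow T r c"
  shows "r \<in> all_row_labels T" "c \<in> cols" "- c < r" "r \<in> rows \<or> \<not> has_up_arrow T (- r)"
proof -
  show *: "r \<in> all_row_labels T" "c \<in> cols" and "- c < r"
    using left_arrow_cell[OF assms] assms by (auto simp: cells_iff left_arrow_def)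
  show "r \<in> rows \<or> \<not> has_up_arrow T (- r)"
    using * assms no_arrow_above_diagonal_zero[of "- r" c] by (auto simp: all_row_labels_iff)
qed

text \<open>A row with a restricted 0 has a rightmost one. If it is diagonal, the column with that
  diagonal cell has an up arrow; otherwise it carries a left arrow. Both exclude the row from
  \<open>alive\<close>.\<close>

lemma unrestricted_rows_eq: "{r. unrestricted_row T r} = alive (int n + 1)"
proof (intro set_eqI iffI; simp)
  fix r
  assume r: "unrestricted_row T r"
  then have "\<not> left_arrow T r c" for c
    by (auto simp: unrestricted_row_def left_arrow_def)
  moreover have "\<not> has_up_arrow T (- r)" if "r \<notin> rows"
    using r that has_up_arrow_iff[of "- r"]
    by (auto simp: unrestricted_row_def all_row_labels_iff restricted_zero_def)
  ultimately show "r \<in> alive (int n + 1)"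
    using r by (auto simp: alive_def unrestricted_row_def)
next
  fix r
  assume "r \<in> alive (int n + 1)"
  then have r: "r \<in> all_row_labels T" "r \<in> rows \<or> \<not> has_up_arrow T (- r)"
    and no_left: "\<And>c. \<not> left_arrow T r c"
    using colsD left_arrowD(2) by (force simp: alive_def)+
  have "\<not> restricted_zero T r c" for c
  proof
    assume "restricted_zero T r c"
    let ?C = "{c. restricted_zero T r c}"
    have "finite ?C"
      using finite_cells_row[of "\<lambda>_. True" r]
      by (rule rev_finite_subset) (auto simp: restricted_zero_def zeros_def)
    moreover have "?C \<noteq> {}" using \<open>restricted_zero T r c\<close> by auto
    ultimately obtain m where "m = Min ?C" and m: "restricted_zero T r m"
      using Min_in by blast
    then have min: "m \<le> c'" if "restricted_zero T r c'" for c'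
      using \<open>finite ?C\<close> that by auto
    have "r \<noteq> - m"
    proof
      assume *: "r = - m"
      then have z: "(- m, m) \<in> zeros T"
        using m by (simp add: restricted_zero_def)
      then have "m \<in> cols" by (auto simp: zeros_def cells_iff)
      then have "has_up_arrow T (- r)" "r \<notin> rows"
        using z * has_up_arrow_iff rowsD[of r] colsD[of m] by auto
      then show False using r(2) by simp
    qed
    then have "left_arrow T r m" using m min by (auto simp: left_arrow_def not_less)
    then show False using no_left by blast
  qed
  then show "unrestricted_row T r" using r by (simp add: unrestricted_row_def)
qed

lemma all_less_add1: "(\<forall>c<b + 1. P c) \<longleftrightarrow> (\<forall>c<b. P c) \<and> P b" for b :: int
  by (auto simp: order_le_less)

lemma alive_not_col:
  assumes "b \<notin> cols"
  shows "alive b = alive (b + 1)"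
proof -
  have "\<not> left_arrow T r b" for r using assms left_arrowD(2) by blast
  moreover have "b + 1 \<le> c \<longleftrightarrow> b \<le> c" if "c \<in> cols" for c
    using assms that by (auto simp: order_le_less)
  ultimately show ?thesis unfolding alive_def all_less_add1 by (simp cong: conj_cong)
qed

text \<open>A row has at most one left arrow, so its letter joins at exactly one column; the letter
  of a column with an up arrow joins at that column.\<close>

lemma alive_col:
  assumes "c \<in> cols"
  shows "alive c = alive (c + 1) \<union> {r. left_arrow T r c} \<union> (if has_up_arrow T c then {c} else {})"
proof -
  let ?X = "\<lambda>b. {r \<in> all_row_labels T. (r \<in> rows \<or> \<not> has_up_arrow T (- r)) \<and>
    (\<forall>c<b. \<not> left_arrow T r c)}"
  let ?Y = "\<lambda>b. {c \<in> cols. b \<le> c \<and> has_up_arrow T c}"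
  have "\<not> left_arrow T r c'" if "left_arrow T r c" "c' < c" for r c'
    using left_arrow_unique[OF that(1)] that(2) by blast
  then have "?X c = ?X (c + 1) \<union> {r. left_arrow T r c}"
    unfolding all_less_add1 using left_arrowD by blast
  moreover have "?Y c = ?Y (c + 1) \<union> (if has_up_arrow T c then {c} else {})"
    using assms by (auto simp: order_le_less)
  ultimately show ?thesis unfolding alive_def by blast
qed

lemma left_arrow_not_alive: "left_arrow T r c \<Longrightarrow> r \<notin> alive (c + 1)"
  using left_arrowD(1)[of r c] row_not_col[of r] by (auto simp: alive_def)

lemma col_not_alive: "c \<in> cols \<Longrightarrow> c \<notin> alive (c + 1)"
  using row_not_col[of c] by (auto simp: alive_def)

lemma word_not_col:
  assumes "b \<notin> cols"
  shows "word b = word (b + 1)"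
proof -
  have "{c \<in> cols. b \<le> c} = {c \<in> cols. b + 1 \<le> c}"
    using assms by (auto simp: add1_zle_eq order_less_le)
  then show ?thesis by (simp add: word_def)
qed

lemma word_col:
  assumes "c \<in> cols"
  shows "word c = Phi_step T c (word (c + 1))"
proof -
  let ?C = "{c' \<in> cols. c + 1 \<le> c'}"
  have "{c' \<in> cols. c \<le> c'} = insert c ?C"
    using assms by auto
  moreover have "sorted_list_of_set (insert c ?C) = insort c (sorted_list_of_set ?C)"
    using finite_cols by (intro sorted_list_of_set.sorted_key_list_of_set_insert) auto
  moreover have "\<dots> = c # sorted_list_of_set ?C"
    using finite_cols by (intro insort_is_Cons) auto
  ultimately show ?thesis by (simp add: word_def)
qed

text \<open>A row letter already present has no left arrow in Column \<open>b\<close>, so only an up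
  arrow or the diagonal could turn its path there. For a column letter that has exited,
  \<open>cont\<close> does nothing.\<close>

lemma cont_step:
  assumes "y \<in> alive (b + 1)" "\<not> up_arrow T y b" "y \<noteq> - b"
  shows "cont (b + 1) y = cont b y"
proof (cases "y \<in> rows \<or> - y \<in> cols \<and> - y < b")
  case True
  then have "y \<notin> cols" using row_not_col by (auto simp: all_row_labels_iff)
  then have "\<not> left_arrow T y b" using assms(1) by (auto simp: alive_def)
  then have "east_exit T y (b + 1) = east_exit T y b"
    using assms by (intro east_exit_skip) (auto simp: order_antisym_conv)
  then show ?thesis using True by (auto simp: cont_def)
next
  case False
  then show ?thesis using assms(3) by (auto simp: cont_def)
qed

end

lemma insert_before_append:
  "y \<notin> set u \<Longrightarrow> insert_before xs y (u @ y # v) = u @ xs @ y # v"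
  by (induction u) (auto simp: insert_before_def)

text \<open>
  Read \<open>S q\<close> as the end of the path that travels south in the current column just below Row \<open>q\<close>,
  and \<open>K y\<close> as the end of the path that has left the column at \<open>y\<close>. The rows with a left arrow are
  inserted from top to bottom: as long as rows are missing, the letter \<open>t\<close> stands for the path
  below the last inserted row.
\<close>

lemma phi_insert_rows:
  assumes "\<forall>x\<in>set (u @ t # v). E x = (if phi (u @ t # v) x = t then S q else K (phi (u @ t # v) x))"
    and "distinct (u @ rs @ t # v)" "sorted rs" "set rs = {r. q < r \<and> A r}"
    and "z \<in> set (t # v)" "\<forall>r\<in>set rs. z < r"
    and "\<And>p r. q \<le> p \<Longrightarrow> p < r \<Longrightarrow> A r \<Longrightarrow> (\<And>r'. p < r' \<Longrightarrow> r' < r \<Longrightarrow> \<not> A r') \<Longrightarrow> S p = K r"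
    and "\<And>p. q \<le> p \<Longrightarrow> (\<And>r. p < r \<Longrightarrow> \<not> A r) \<Longrightarrow> S p = K t"
    and "\<forall>r\<in>set rs. E r = S r"
  shows "\<forall>x\<in>set (u @ rs @ t # v). E x = K (phi (u @ rs @ t # v) x)"
  using assms
proof (induction rs arbitrary: u q)
  case Nil
  have "S q = K t" using Nil(4) by (intro Nil(8)) auto
  then show ?case using Nil(1) by auto
next
  case (Cons r rs)
  let ?w = "u @ t # v"
  have dist: "distinct ?w" "r \<notin> set ?w" "r \<noteq> t" using Cons.prems(2) by auto
  have r: "q < r" "A r" using Cons.prems(4) by auto
  have phi': "phi (u @ r # t # v) = transpose r t \<circ> phi ?w"
    using Cons.prems(2,5,6) by (intro phi_insert) auto
  have perm: "phi ?w permutes set ?w" by (rule phi_permutes[OF dist(1)])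
  \<comment> \<open>As head of the sorted list, \<open>r\<close> is the first row with a left arrow
    that a path going south from \<open>q\<close> meets.\<close>
  have no_A: "\<not> A r'" if "q < r'" "r' < r" for r'
  proof
    assume "A r'"
    then have "r' \<in> set (r # rs)" using that(1) Cons.prems(4) by auto
    then show False using that(2) Cons.prems(3) by auto
  qed
  have Sq: "S q = K r" by (rule Cons.prems(7)) (use r no_A in auto)
  have rs: "set rs = {r'. r < r' \<and> A r'}"
  proof -
    have "set rs = set (r # rs) - {r}" using Cons.prems(2) by auto
    also have "\<dots> = {r'. q < r' \<and> A r'} - {r}" by (simp only: Cons.prems(4))
    also have "\<dots> = {r'. r < r' \<and> A r'}"
    proof -
      have "q < r' \<and> A r' \<and> r' \<noteq> r \<longleftrightarrow> r < r' \<and> A r'" for r'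
        using no_A[of r'] r(1) by (cases "r' < r") auto
      then show ?thesis by blast
    qed
    finally show ?thesis .
  qed
  \<comment> \<open>The inserted row joins the prefix, and the open southbound path now starts at
    \<open>r\<close> instead of \<open>q\<close>.\<close>
  have "\<forall>x\<in>set ((u @ [r]) @ rs @ t # v). E x = K (phi ((u @ [r]) @ rs @ t # v) x)"
  proof (rule Cons.IH)
    show "\<forall>x\<in>set ((u @ [r]) @ t # v). E x =
      (if phi ((u @ [r]) @ t # v) x = t then S r else K (phi ((u @ [r]) @ t # v) x))"
    proof
      fix x
      assume "x \<in> set ((u @ [r]) @ t # v)"
      then consider "x = r" | "x \<in> set ?w" by auto
      then show "E x = (if phi ((u @ [r]) @ t # v) x = t then S r else K (phi ((u @ [r]) @ t # v) x))"
      proof cases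
        case 1
        then have "phi ?w x = r" using permutes_not_in[OF perm] dist(2) by blast
        then show ?thesis using 1 Cons.prems(9) by (simp add: phi')
      next
        case 2
        then have "phi ?w x \<in> set ?w" using permutes_in_image[OF perm] by blast
        then have "phi ?w x \<noteq> r" using dist(2) by blast
        then show ?thesis using bspec[OF Cons.prems(1) 2] dist(3) Sq
          by (cases "phi ?w x = t") (simp_all add: phi')
      qed
    qed
    show "S p = K r'" if "r \<le> p" "p < r'" "A r'" "\<And>q'. p < q' \<Longrightarrow> q' < r' \<Longrightarrow> \<not> A q'" for p r'
      by (rule Cons.prems(7)) (use that r in auto)
    show "S p = K t" if "r \<le> p" "\<And>r. p < r \<Longrightarrow> \<not> A r" for p
      by (rule Cons.prems(8)) (use that r in auto)
  qed (use Cons.prems(2,3,5,6,9) rs in auto)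
  then show ?case by simp
qed

section \<open>Following the paths column by column\<close>

context type_B_tableau
begin

abbreviation exit_letter :: "int \<Rightarrow> int" where
  "exit_letter x \<equiv> signed_label T (path_exit T \<bar>x\<bar>)"

lemma row_letter_exit:
  assumes "left_arrow T r c"
  shows "exit_letter r = signed_label T (south_exit T r c)"
proof -
  have rc: "r \<in> all_row_labels T" "c \<in> cols" "- c < r" using left_arrowD[OF assms] by simp_all
  have "path_exit T \<bar>r\<bar> = east_exit T r (int n + 1)"
    using rc(1) by (simp add: path_exit_eq start_row_row)
  also have "\<dots> = east_exit T r (c + 1)"
    using no_arrow_before_left_arrow[OF assms] rc colsD[of c]
    by (intro east_exit_skip) (auto simp: add1_zle_eq)
  also have "\<dots> = south_exit T r c" using assms by (intro east_exit_arrow) simp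
  finally show ?thesis by simp
qed

text \<open>Row \<open>- c\<close> is free of arrows, so its path turns at the diagonal; going south
  it meets the up arrow first, since the left arrows of the column lie below it.\<close>

lemma col_letter_exit:
  assumes "c \<in> cols" "up_arrow T r c"
  shows "exit_letter c = signed_label T (east_exit T r c)"
proof -
  have "has_up_arrow T c" using assms(2) by (auto simp: has_up_arrow_def)
  note no = no_arrow_above_diagonal_zero[OF assms(1) this]
  have "path_exit T \<bar>c\<bar> = east_exit T (- c) (int n + 1)"
    using colsD[OF assms(1)] by (simp add: path_exit_eq start_row_def)
  also have "\<dots> = east_exit T (- c) (c + 1)"
    using no colsD[OF assms(1)] by (intro east_exit_skip) auto
  also have "\<dots> = south_exit T (- c) c" by (rule east_exit_diagonal[OF assms(1)])
  also have "\<dots> = east_exit T r c"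
  proof (rule south_exit_arrow)
    show "- c < r" using up_arrow_cell[OF assms(2)] assms(2) by (auto simp: cells_iff up_arrow_def)
    show "\<not> arrow r' c" if "r' < r" for r'
      using that up_arrow_unique[OF assms(2), of r'] left_arrow_below_up_arrow[OF assms(2), of r'] by auto
  qed (use assms(2) in simp)
  finally show ?thesis by simp
qed

lemma finite_left_arrows: "finite {r. left_arrow T r c}"
  by (rule finite_subset[OF _ finite_cells_column[of "\<lambda>_. True" c]]) (auto intro: left_arrow_cell)

text \<open>The induction invariant: the true end of each path equals the end obtained by resuming,
  at the border \<open>b\<close>, from the letter that \<open>phi\<close> of the partial word
  assigns.\<close>

definition traced :: "int \<Rightarrow> bool" where
  "traced b \<longleftrightarrow> distinct (word b) \<and> set (word b) = alive b \<and>
     (\<forall>x\<in>alive b. exit_letter x = cont b (phi (word b) x))"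

lemma traced_start: "traced (int n + 1)"
proof -
  have no_col: "{c \<in> cols. int n + 1 \<le> c} = {}" using colsD by force
  then have w: "word (int n + 1) = sorted_list_of_set (alive (int n + 1))"
    unfolding word_def unrestricted_rows_eq no_col by simp
  have rows: "alive (int n + 1) \<subseteq> all_row_labels T"
    using colsD by (force simp: alive_def)
  moreover have "finite (all_row_labels T)"
    by (rule finite_subset[of _ "{- int n..int n}"])
      (use rowsD colsD in \<open>force simp: all_row_labels_def\<close>)+
  ultimately have "finite (alive (int n + 1))" by (rule finite_subset)
  moreover have "exit_letter x = cont (int n + 1) x" if "x \<in> alive (int n + 1)" for x
  proof -
    have x: "x \<in> all_row_labels T" using rows that by blast
    then have "x \<in> rows \<or> - x \<in> cols \<and> - x < int n + 1"
      using colsD[of "- x"] by (auto simp: all_row_labels_iff)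
    then show ?thesis using x by (simp add: cont_def path_exit_eq start_row_row)
  qed
  ultimately show ?thesis by (simp add: traced_def w phi_sorted)
qed

text \<open>In a column, its own letter \<open>?t\<close> is settled first, standing for a path
  still running south from Row \<open>q\<close>; \<open>phi_insert_rows\<close> then adds the rows
  with left arrows.\<close>

lemma traced_step:
  assumes "traced (b + 1)" "1 \<le> b"
  shows "traced b"
proof (cases "b \<in> cols")
  case False
  have "cont (b + 1) y = cont b y" if "y \<in> alive (b + 1)" for y
  proof (rule cont_step[OF that])
    show "\<not> up_arrow T y b" using False up_arrow_cell by (auto simp: cells_iff)
    show "y \<noteq> - b"
      using False that assms(2) rowsD[of y] colsD[of y] by (auto simp: alive_def all_row_labels_iff)
  qed
  moreover have "phi (word (b + 1)) x \<in> alive (b + 1)" if "x \<in> alive (b + 1)" for x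
  proof -
    have w: "distinct (word (b + 1))" "set (word (b + 1)) = alive (b + 1)"
      using assms(1) by (simp_all add: traced_def)
    then show ?thesis using that permutes_in_image[OF phi_permutes[OF w(1)]] by simp
  qed
  ultimately show ?thesis
    using assms(1) by (simp add: traced_def word_not_col[OF False] alive_not_col[OF False])
next
  case b: True
  let ?w = "word (b + 1)"
  let ?rs = "sorted_list_of_set {r. left_arrow T r b}"
  let ?S = "\<lambda>q. signed_label T (south_exit T q b)"
  let ?t = "signed_label T b"
  have w: "distinct ?w" "set ?w = alive (b + 1)"
    and E: "\<And>x. x \<in> set ?w \<Longrightarrow> exit_letter x = cont (b + 1) (phi ?w x)"
    using assms(1) by (simp_all add: traced_def)
  have perm: "phi ?w permutes set ?w" by (rule phi_permutes[OF w(1)])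
  have phi_in: "phi ?w x \<in> alive (b + 1)" if "x \<in> set ?w" for x
    using that permutes_in_image[OF perm] w(2) by blast
  have rs: "sorted ?rs" "distinct ?rs" "set ?rs = {r. left_arrow T r b}" "set ?rs \<inter> set ?w = {}"
    using finite_left_arrows left_arrow_not_alive w(2) by auto
  have b_new: "b \<notin> set ?w" using col_not_alive[OF b] w(2) by simp
  have b_not_row: "b \<notin> set ?rs" using left_arrowD(1) row_not_col b rs(3) by blast
  have K_row: "cont b r = signed_label T (east_exit T r b)" if "left_arrow T r b" for r
    using left_arrowD[OF that] by (auto simp: cont_def all_row_labels_iff)
  \<comment> \<open>Leaving at the bottom of Column \<open>b\<close> means stopping at
    \<open>?t\<close>. For \<open>?t = - b\<close> this rests on the strict inequality in
    \<open>cont\<close>: at border \<open>b\<close> the diagonal of Row \<open>- b\<close> has been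
    passed.\<close>
  have t_end: "signed_label T b = cont b ?t"
    using b colsD[OF b] rowsD[of "- b"] colsD[of "- b"] by (auto simp: cont_def signed_label_def)
  have E_rows: "\<forall>r\<in>set ?rs. exit_letter r = ?S r" using row_letter_exit rs(3) by blast
  \<comment> \<open>Common form of the two cases: \<open>q\<close> is the row of the up arrow or
    \<open>- b\<close>, and \<open>z\<close>, equal to \<open>q\<close>, stands behind the new row
    letters and is smaller.\<close>
  obtain u z v q where word: "word b = u @ ?rs @ ?t # v"
    and dist: "distinct (u @ ?rs @ ?t # v)"
    and set: "set (u @ ?t # v) = alive (b + 1) \<union> (if has_up_arrow T b then {b} else {})"
    and z: "z \<in> set (?t # v)" "\<forall>r\<in>set ?rs. z < r"
    and below: "\<And>r. left_arrow T r b \<Longrightarrow> q < r" "\<And>r. q < r \<Longrightarrow> \<not> up_arrow T r b"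
    and start: "\<forall>x\<in>set (u @ ?t # v). exit_letter x =
      (if phi (u @ ?t # v) x = ?t then ?S q else cont b (phi (u @ ?t # v) x))"
  proof (cases "has_up_arrow T b")
    case True
    then obtain r0 where r0: "up_arrow T r0 b" by (auto simp: has_up_arrow_def)
    have the: "(THE r. up_arrow T r b) = r0"
      by (rule the_equality) (rule r0, rule up_arrow_unique[OF _ r0])
    have t: "?t = b" using True by (simp add: signed_label_def)
    have cell: "r0 \<in> all_row_labels T" "r0 < b" using up_arrow_cell[OF r0] by (auto simp: cells_iff)
    \<comment> \<open>A left arrow further right in Row \<open>r0\<close> would forbid the up arrow,
      and one in the same cell would lie strictly below it. Hence the letter \<open>r0\<close> is
      already in the word.\<close>
    have "\<not> left_arrow T r0 c" if "c < b + 1" for c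
      using that no_arrow_before_left_arrow[of r0 c b] left_arrow_below_up_arrow[OF r0, of r0] r0
      by (cases "c = b") auto
    moreover have "r0 \<in> rows \<or> \<not> has_up_arrow T (- r0)"
      using cell(1) no_arrow_above_diagonal_zero[of "- r0" b] r0 by (auto simp: all_row_labels_iff)
    ultimately have "r0 \<in> set ?w" using cell(1) w(2) by (simp add: alive_def)
    then obtain u v where uv: "?w = u @ r0 # v" by (meson split_list)
    have r0_u: "r0 \<notin> set u" and bu: "b \<notin> set u" using w(1) uv b_new by auto
    let ?w' = "u @ b # r0 # v"
    have phi': "phi ?w' = transpose b r0 \<circ> phi ?w"
      unfolding uv using w(1) b_new cell(2) uv by (intro phi_insert[where z = r0]) auto
    have K_r0: "cont b r0 = signed_label T (east_exit T r0 b)"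
      using up_arrow_cell[OF r0] r0 by (auto simp: cont_def cells_iff all_row_labels_iff up_arrow_def)
    have K'_r0: "cont (b + 1) r0 = ?S r0"
      using up_arrow_cell[OF r0] r0 east_exit_arrow[of r0 b]
      by (auto simp: cont_def cells_iff all_row_labels_iff)
    show thesis
    proof (rule that[where u = u and v = "r0 # v" and q = r0 and z = r0])
      show "word b = u @ ?rs @ ?t # r0 # v"
        using True r0_u bu by (simp add: word_col[OF b] Phi_step_def the t uv insert_before_append)
      show "distinct (u @ ?rs @ ?t # r0 # v)"
        using w(1) rs(2,4) b_new b_not_row unfolding uv t by auto
      show "set (u @ ?t # r0 # v) = alive (b + 1) \<union> (if has_up_arrow T b then {b} else {})"
        using True w(2) unfolding uv t by auto
      show "\<forall>r\<in>set ?rs. r0 < r" using rs(3) left_arrow_below_up_arrow[OF r0] by blast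
      show "\<forall>x\<in>set (u @ ?t # r0 # v). exit_letter x =
        (if phi (u @ ?t # r0 # v) x = ?t then ?S r0 else cont b (phi (u @ ?t # r0 # v) x))"
        unfolding t
      proof
        fix x
        assume "x \<in> set ?w'"
        then consider "x = b" | "x \<in> set ?w" using uv by auto
        then show "exit_letter x = (if phi ?w' x = b then ?S r0 else cont b (phi ?w' x))"
        proof cases
          case 1
          then have "phi ?w x = b" using permutes_not_in[OF perm] b_new by blast
          then show ?thesis using 1 col_letter_exit[OF b r0] K_r0 cell(2) by (simp add: phi')
        next
          \<comment> \<open>The letter formerly sent to \<open>r0\<close> now goes to
            \<open>b\<close>, and its path turns south at the up arrow; all other paths cross the
            column unchanged.\<close>
          case 2
          then have "phi ?w x \<noteq> b" using phi_in[OF 2] b_new w(2) by auto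
          moreover have "cont (b + 1) (phi ?w x) = cont b (phi ?w x)" if "phi ?w x \<noteq> r0"
          proof (rule cont_step[OF phi_in[OF 2]])
            show "\<not> up_arrow T (phi ?w x) b" using that up_arrow_unique[OF r0] by blast
            show "phi ?w x \<noteq> - b"
              using phi_in[OF 2] True b colsD[OF b] colsD[of "- b"] rowsD[of "- b"] by (auto simp: alive_def)
          qed
          ultimately show ?thesis using E[OF 2] K'_r0
            by (cases "phi ?w x = r0") (simp_all add: phi')
        qed
      qed
      show "r0 < r" if "left_arrow T r b" for r using left_arrow_below_up_arrow[OF r0 that] .
      show "\<not> up_arrow T r b" if "r0 < r" for r using that up_arrow_unique[OF r0, of r] by blast
    qed simp
  next
    case False
    then have t: "?t = - b" using b by (simp add: signed_label_def)
    have no_up: "\<not> up_arrow T r b" for r using False by (auto simp: has_up_arrow_def)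
    have "- b \<in> all_row_labels T" using b by (simp add: all_row_labels_iff)
    \<comment> \<open>Row \<open>- b\<close> ends at its diagonal cell, so any left arrow in it lies
      to the left of Column \<open>b\<close>; thus \<open>- b\<close> is already in the
      word.\<close>
    moreover have "\<not> left_arrow T (- b) c" if "c < b + 1" for c
      using that left_arrowD(3)[of "- b" c] by auto
    ultimately have "- b \<in> set ?w" using False w(2) by (auto simp: alive_def)
    then obtain u v where uv: "?w = u @ - b # v" by (meson split_list)
    have b_u: "- b \<notin> set u" using w(1) uv by auto
    have K'_t: "cont (b + 1) (- b) = ?S (- b)"
      using b east_exit_diagonal[OF b] by (simp add: cont_def)
    show thesis
    proof (rule that[where u = u and v = v and q = "- b" and z = "- b"])
      show "word b = u @ ?rs @ ?t # v"
        using False b_u by (simp add: word_col[OF b] Phi_step_def t uv insert_before_append)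
      show "distinct (u @ ?rs @ ?t # v)"
        using w(1) rs(2,4) unfolding uv t by auto
      show "set (u @ ?t # v) = alive (b + 1) \<union> (if has_up_arrow T b then {b} else {})"
        using False w(2) unfolding uv t by auto
      show "\<forall>r\<in>set ?rs. - b < r" using rs(3) left_arrowD(3) by blast
      show "\<forall>x\<in>set (u @ ?t # v). exit_letter x =
        (if phi (u @ ?t # v) x = ?t then ?S (- b) else cont b (phi (u @ ?t # v) x))"
        unfolding t uv[symmetric]
      proof
        fix x
        assume x: "x \<in> set ?w"
        show "exit_letter x = (if phi ?w x = - b then ?S (- b) else cont b (phi ?w x))"
        proof (cases "phi ?w x = - b")
          case True
          then show ?thesis using E[OF x] K'_t by simp
        next
          case False
          then show ?thesis using E[OF x] cont_step[OF phi_in[OF x] no_up] by simp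
        qed
      qed
      show "- b < r" if "left_arrow T r b" for r using left_arrowD(3)[OF that] .
      show "- b \<in> set (?t # v)" using t by simp
    qed (rule no_up)
  qed
  have "\<forall>x\<in>set (u @ ?rs @ ?t # v). exit_letter x = cont b (phi (u @ ?rs @ ?t # v) x)"
  proof (rule phi_insert_rows[where S = ?S and q = q and A = "\<lambda>r. left_arrow T r b"])
    show "set ?rs = {r. q < r \<and> left_arrow T r b}" using rs(3) below(1) by blast
    show "?S p = cont b r" if "q \<le> p" "p < r" "left_arrow T r b"
      "\<And>r'. p < r' \<Longrightarrow> r' < r \<Longrightarrow> \<not> left_arrow T r' b" for p r
    proof -
      have "south_exit T p b = east_exit T r b"
        using that below(2) by (intro south_exit_arrow) auto
      then show ?thesis using K_row that(3) by simp
    qed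
    show "?S p = cont b ?t" if "q \<le> p" "\<And>r. p < r \<Longrightarrow> \<not> left_arrow T r b" for p
    proof -
      have "south_exit T p b = b"
        using that below(2) by (intro south_exit_bottom) auto
      then show ?thesis using t_end by simp
    qed
  qed (rule start dist rs(1) z E_rows)+
  moreover have "set (u @ ?rs @ ?t # v) = alive b"
    using set rs(3) alive_col[OF b] by auto
  ultimately show ?thesis unfolding traced_def word using dist by (simp only: simp_thms)
qed

lemma traced_all: "b \<le> int n + 1 \<Longrightarrow> 1 \<le> b \<Longrightarrow> traced b"
proof (induction b rule: int_le_induct)
  case base
  show ?case by (rule traced_start)
next
  case (step i)
  then show ?case using traced_step[of "i - 1"] by simp
qed

section \<open>The state after the last column\<close>

lemma word_1: "word 1 = Phi_B T"
proof -
  have "{c \<in> cols. 1 \<le> c} = cols" using colsD by blast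
  then show ?thesis by (simp add: word_def Phi_B_def)
qed

lemma alive_1: "alive 1 = signed_labels T"
proof -
  have "\<not> left_arrow T r c" if "c < 1" for r c
    using that left_arrowD(2)[of r c] colsD[of c] by auto
  then have "alive 1 = {r \<in> all_row_labels T. r \<in> rows \<or> \<not> has_up_arrow T (- r)}
     \<union> {c \<in> cols. has_up_arrow T c}"
    using colsD by (auto simp: alive_def)
  also have "\<dots> = signed_labels T"
    using colsD rowsD
    by (force simp: signed_labels_def signed_label_def all_row_labels_def)
  finally show ?thesis .
qed

text \<open>Column labels are positive, so past the border 1 no path has a cell left to cross, and
  the invariant becomes the equality of the two maps on \<open>R(T)\<close>.\<close>

lemma cont_1:
  assumes "y \<in> alive 1"
  shows "cont 1 y = y"
proof (cases "y \<in> rows")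
  case True
  have "{c. c < 1 \<and> (y, c) \<in> cells T} = {}" using colsD by (force simp: cells_iff)
  then have "east_exit T y 1 = y" by (simp add: east_exit_def)
  then show ?thesis using True rowsD[of y] by (simp add: cont_def signed_label_def)
next
  case False
  then show ?thesis using colsD[of "- y"] by (auto simp: cont_def)
qed

lemma Phi_B_distinct: "distinct (Phi_B T)"
  and set_Phi_B: "set (Phi_B T) = signed_labels T"
  using traced_all[of 1] by (simp_all add: traced_def word_1 alive_1)

lemma Phi_B_type_B: "Phi_B T \<in> type_B_perms n"
proof -
  have abs: "\<bar>signed_label T i\<bar> = i" if "i \<in> {1..int n}" for i
    using that by (simp add: signed_label_def)
  have "signed_labels T = signed_label T ` {1..int n}" by (simp add: signed_labels_def labels_Un)
  then have "abs ` signed_labels T = {1..int n}" "inj_on abs (signed_labels T)"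
    using abs by (force simp: image_image, auto simp: inj_on_def)
  then show ?thesis
    by (simp add: type_B_perms_def distinct_map Phi_B_distinct set_Phi_B)
qed

lemma zeta_alt_B_eq: "zeta_alt_B T = phi (Phi_B T)"
proof
  fix x
  have perm: "phi (Phi_B T) permutes signed_labels T"
    using phi_permutes[OF Phi_B_distinct] by (simp add: set_Phi_B)
  show "zeta_alt_B T x = phi (Phi_B T) x"
  proof (cases "x \<in> signed_labels T")
    case True
    then have "exit_letter x = cont 1 (phi (Phi_B T) x)"
      using traced_all[of 1] by (simp add: traced_def word_1 alive_1)
    also have "\<dots> = phi (Phi_B T) x"
      using True permutes_in_image[OF perm] by (intro cont_1) (simp add: alive_1)
    finally show ?thesis using True by (simp add: zeta_alt_B_def)
  next
    case False
    then show ?thesis using permutes_not_in[OF perm] by (simp add: zeta_alt_B_def)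
  qed
qed

end

theorem theorem5p2:
  fixes n :: nat and T :: filled_diagram
  assumes "n \<ge> 1" and "T \<in> PT_B n"
  shows "Phi_B T \<in> type_B_perms n \<and> set (Phi_B T) = signed_labels T \<and>
         zeta_alt_B T permutes signed_labels T \<and>
         phi (Phi_B T) permutes signed_labels T \<and>
         zeta_alt_B T = phi (Phi_B T)"
proof -
  interpret type_B_tableau n T by unfold_locales (rule assms(2))
  show ?thesis
    using Phi_B_type_B set_Phi_B zeta_alt_B_eq phi_permutes[OF Phi_B_distinct] by simp
qed

end
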